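(* Let $\Gamma$ be a graph, let $G \leq \mathrm{Aut}(\Gamma)$ be such that $\Gamma/G$ is a tree, and let $\Gamma'$ be a subgraph of $\Gamma$ that is mapped isomorphically onto $\Gamma/G$ by the quotient map $x\mapsto x^G$. Then $\Gamma$ is connected if and only if $G = \langle G_v \mid v \in V(\Gamma') \rangle$.
   Context: A graph is a quadruple $(V,D,\mathrm{beg},\mathrm{inv})$ where $V$ is a non-empty set of vertices, $D$ is a set of darts (disjoint from $V$), $\mathrm{beg}\colon D\to V$, and $\mathrm{inv}\colon D\to D$ satisfies $\mathrm{inv}\,\mathrm{inv}\,x=x$ for all $x\in D$. For $\Gamma=(V,D,\mathrm{beg},\mathrm{inv})$ write $V(\Gamma)=V$, $D(\Gamma)=D$; $x^{-1}:=\mathrm{inv}\,x$ and $\mathrm{end}\,x:=\mathrm{beg}\,x^{-1}$. A subgraph of $\Gamma$ is a graph $(V',D',\mathrm{beg}',\mathrm{inv}')$ with $V'\subseteq V$, $D'\subseteq D$ and $\mathrm{beg}',\mathrm{inv}'$ the restrictions of $\mathrm{beg},\mathrm{inv}$ to $D'$. A walk is a sequence of darts $(x_1,\dots,x_n)$ with $\mathrm{end}\,x_i=\mathrm{beg}\,x_{i+1}$; a walk of length $0$ is regarded as a walk from any vertex to itself. A graph is connected if for any two vertices $u,v$ there is a walk from $u$ to $v$. An edge is a pair $\{x,x^{-1}\}$; it is a semi-edge if $x=x^{-1}$ and a loop if $x\ne x^{-1}$ but $\mathrm{beg}\,x=\mathrm{end}\,x$; two distinct edges are parallel if they have the same endvertices.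 A graph is simple if it has no semi-edges, loops, or pairs of distinct parallel edges. A tree is a connected graph with no cycles; a tree is always a simple graph (so this is a tree in the usual sense for simple graphs). A morphism of graphs is a function mapping vertices to vertices and darts to darts and commuting with $\mathrm{beg}$ and $\mathrm{inv}$; isomorphisms are bijective morphisms, automorphisms are isomorphisms of a graph onto itself; $\mathrm{Aut}(\Gamma)$ acts on the right, with the image of $x$ under $g$ denoted $x^g$. For $G\le\mathrm{Aut}(\Gamma)$, $x^G$ is the $G$-orbit of $x$, $G_x$ is the stabiliser of $x$ in $G$, and $\Gamma/G$ is the graph whose vertices and darts are the $G$-orbits on $V(\Gamma)$ and on $D(\Gamma)$, with $\mathrm{beg}(x^G)=(\mathrm{beg}\,x)^G$ and $\mathrm{inv}(x^G)=(\mathrm{inv}\,x)^G$. The quotient map is $x\mapsto x^G$ on $V(\Gamma)\cup D(\Gamma)$. *)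

theory Defs
  imports "HOL-Algebra.Group_Action" "HOL-Algebra.Generated_Groups"
begin

section \<open>Graphs with darts\<close>

text \<open>
  Vertices and darts are taken from one type and are required to be disjoint, so that morphisms,
  automorphisms and the quotient map are single functions on vertices and darts together.
  The values of \<open>beg\<close> and \<open>dinv\<close> outside the darts are irrelevant.
\<close>

record 'a dart_graph =
  verts :: "'a set"
  darts :: "'a set"
  beg :: "'a \<Rightarrow> 'a"
  dinv :: "'a \<Rightarrow> 'a"

definition is_graph :: "'a dart_graph \<Rightarrow> bool" where
  "is_graph \<Gamma> \<longleftrightarrow>
     verts \<Gamma> \<noteq> {} \<and> verts \<Gamma> \<inter> darts \<Gamma> = {} \<and>
     (\<forall>x \<in> darts \<Gamma>. beg \<Gamma> x \<in> verts \<Gamma>) \<and>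
     (\<forall>x \<in> darts \<Gamma>. dinv \<Gamma> x \<in> darts \<Gamma> \<and>
        dinv \<Gamma> (dinv \<Gamma> x) = x)"

abbreviation elems :: "'a dart_graph \<Rightarrow> 'a set" where
  "elems \<Gamma> \<equiv> verts \<Gamma> \<union> darts \<Gamma>"

definition dend :: "'a dart_graph \<Rightarrow> 'a \<Rightarrow> 'a" where
  "dend \<Gamma> x = beg \<Gamma> (dinv \<Gamma> x)"

definition is_subgraph :: "'a dart_graph \<Rightarrow> 'a dart_graph \<Rightarrow> bool" where
  "is_subgraph \<Delta> \<Gamma> \<longleftrightarrow>
     is_graph \<Delta> \<and> verts \<Delta> \<subseteq> verts \<Gamma> \<and> darts \<Delta> \<subseteq> darts \<Gamma> \<and>
     (\<forall>x \<in> darts \<Delta>. beg \<Delta> x = beg \<Gamma> x \<and> dinv \<Delta> x = dinv \<Gamma> x)"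

definition walk :: "'a dart_graph \<Rightarrow> 'a list \<Rightarrow> bool" where
  "walk \<Gamma> xs \<longleftrightarrow> set xs \<subseteq> darts \<Gamma> \<and> successively (\<lambda>x y. dend \<Gamma> x = beg \<Gamma> y) xs"

definition walk_from_to :: "'a dart_graph \<Rightarrow> 'a \<Rightarrow> 'a list \<Rightarrow> 'a \<Rightarrow> bool" where
  "walk_from_to \<Gamma> u xs v \<longleftrightarrow>
     u \<in> verts \<Gamma> \<and> v \<in> verts \<Gamma> \<and> walk \<Gamma> xs \<and>
     (if xs = [] then u = v else beg \<Gamma> (hd xs) = u \<and> dend \<Gamma> (last xs) = v)"

definition graph_connected :: "'a dart_graph \<Rightarrow> bool" where
  "graph_connected \<Gamma> \<longleftrightarrow> (\<forall>u \<in> verts \<Gamma>. \<forall>v \<in> verts \<Gamma>. \<exists>xs. walk_from_to \<Gamma> u xs v)"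

definition edge :: "'a dart_graph \<Rightarrow> 'a \<Rightarrow> 'a set" where
  "edge \<Gamma> x = {x, dinv \<Gamma> x}"

definition is_simple :: "'a dart_graph \<Rightarrow> bool" where
  "is_simple \<Gamma> \<longleftrightarrow>
     (\<forall>x \<in> darts \<Gamma>. dinv \<Gamma> x \<noteq> x \<and> beg \<Gamma> x \<noteq> dend \<Gamma> x) \<and>
     (\<forall>x \<in> darts \<Gamma>. \<forall>y \<in> darts \<Gamma>.
        {beg \<Gamma> x, dend \<Gamma> x} = {beg \<Gamma> y, dend \<Gamma> y} \<longrightarrow> edge \<Gamma> x = edge \<Gamma> y)"

text \<open>
  A cycle is a non-empty closed walk that repeats neither a vertex nor an edge. Distinctness of
  the edges only matters at length 2, where it excludes \<open>[x, dinv x]\<close>. A semi-edge or a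
  loop is thus a cycle of length 1, and two parallel edges form a cycle of length 2, which is what
  makes every tree simple (\<open>tree_is_simple\<close> below).
\<close>

definition is_cycle :: "'a dart_graph \<Rightarrow> 'a list \<Rightarrow> bool" where
  "is_cycle \<Gamma> xs \<longleftrightarrow>
     xs \<noteq> [] \<and> walk \<Gamma> xs \<and> dend \<Gamma> (last xs) = beg \<Gamma> (hd xs) \<and>
     distinct (map (beg \<Gamma>) xs) \<and> distinct (map (edge \<Gamma>) xs)"

definition is_tree :: "'a dart_graph \<Rightarrow> bool" where
  "is_tree \<Gamma> \<longleftrightarrow> is_graph \<Gamma> \<and> graph_connected \<Gamma> \<and> (\<nexists>xs. is_cycle \<Gamma> xs)"

lemma tree_is_simple:
  assumes "is_tree \<Gamma>"
  shows "is_simple \<Gamma>"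
proof -
  have g: "is_graph \<Gamma>" and nc: "\<And>xs. \<not> is_cycle \<Gamma> xs"
    using assms by (auto simp: is_tree_def)
  have noloop: "beg \<Gamma> x \<noteq> dend \<Gamma> x" if "x \<in> darts \<Gamma>" for x
    using nc[of "[x]"] that by (auto simp: is_cycle_def walk_def)
  have norev: "dinv \<Gamma> x \<noteq> x" if "x \<in> darts \<Gamma>" for x
    using noloop[OF that] by (auto simp: dend_def)
  have par: "edge \<Gamma> x = edge \<Gamma> y"
    if x: "x \<in> darts \<Gamma>" and y: "y \<in> darts \<Gamma>"
      and e: "beg \<Gamma> x = dend \<Gamma> y" "dend \<Gamma> x = beg \<Gamma> y" for x y
    using nc[of "[x, y]"] x y e noloop[OF x] by (auto simp: is_cycle_def walk_def)
  have "edge \<Gamma> x = edge \<Gamma> y"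
    if x: "x \<in> darts \<Gamma>" and y: "y \<in> darts \<Gamma>"
      and e: "{beg \<Gamma> x, dend \<Gamma> x} = {beg \<Gamma> y, dend \<Gamma> y}" for x y
  proof (cases "beg \<Gamma> x = dend \<Gamma> y \<and> dend \<Gamma> x = beg \<Gamma> y")
    case True
    then show ?thesis using par[OF x y] by simp
  next
    case False
    then have "beg \<Gamma> x = beg \<Gamma> y" "dend \<Gamma> x = dend \<Gamma> y"
      using e by (auto simp: doubleton_eq_iff)
    moreover have "dinv \<Gamma> y \<in> darts \<Gamma>" "dinv \<Gamma> (dinv \<Gamma> y) = y"
      using g y by (auto simp: is_graph_def)
    ultimately have "edge \<Gamma> x = edge \<Gamma> (dinv \<Gamma> y)"
      using par[OF x, of "dinv \<Gamma> y"] by (simp add: dend_def)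
    then show ?thesis
      using \<open>dinv \<Gamma> (dinv \<Gamma> y) = y\<close> by (auto simp: edge_def)
  qed
  then show ?thesis unfolding is_simple_def using noloop norev by blast
qed


section \<open>Morphisms and automorphisms\<close>

definition is_morphism :: "'a dart_graph \<Rightarrow> 'b dart_graph \<Rightarrow> ('a \<Rightarrow> 'b) \<Rightarrow> bool" where
  "is_morphism \<Gamma> \<Delta> f \<longleftrightarrow>
     f ` verts \<Gamma> \<subseteq> verts \<Delta> \<and> f ` darts \<Gamma> \<subseteq> darts \<Delta> \<and>
     (\<forall>x \<in> darts \<Gamma>. f (beg \<Gamma> x) = beg \<Delta> (f x) \<and>
        f (dinv \<Gamma> x) = dinv \<Delta> (f x))"

definition is_isomorphism :: "'a dart_graph \<Rightarrow> 'b dart_graph \<Rightarrow> ('a \<Rightarrow> 'b) \<Rightarrow> bool" where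
  "is_isomorphism \<Gamma> \<Delta> f \<longleftrightarrow> is_morphism \<Gamma> \<Delta> f \<and> bij_betw f (elems \<Gamma>) (elems \<Delta>)"

text \<open>
  Automorphisms are extensional, so that each has a unique representative. The product \<open>g \<otimes> h\<close>
  is ``first \<open>g\<close>, then \<open>h\<close>'', in accordance with the right action \<open>x\<^sup>g\<close>,
  which is rendered as the application \<open>g x\<close>.
\<close>

definition Aut :: "'a dart_graph \<Rightarrow> ('a \<Rightarrow> 'a) monoid" where
  "Aut \<Gamma> =
     \<lparr>carrier = {f \<in> extensional (elems \<Gamma>). is_isomorphism \<Gamma> \<Gamma> f},
      mult = (\<lambda>g h. compose (elems \<Gamma>) h g),
      one = (\<lambda>x \<in> elems \<Gamma>. x)\<rparr>"

lemma Aut_carrierD: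
  assumes "f \<in> carrier (Aut \<Gamma>)"
  shows "f \<in> extensional (elems \<Gamma>)" "bij_betw f (elems \<Gamma>) (elems \<Gamma>)"
    and "\<And>x. x \<in> verts \<Gamma> \<Longrightarrow> f x \<in> verts \<Gamma>" "\<And>x. x \<in> darts \<Gamma> \<Longrightarrow> f x \<in> darts \<Gamma>"
    and "\<And>x. x \<in> darts \<Gamma> \<Longrightarrow> f (beg \<Gamma> x) = beg \<Gamma> (f x)"
    and "\<And>x. x \<in> darts \<Gamma> \<Longrightarrow> f (dinv \<Gamma> x) = dinv \<Gamma> (f x)"
  using assms by (auto simp: Aut_def is_isomorphism_def is_morphism_def)

lemma group_Aut:
  assumes g: "is_graph \<Gamma>"
  shows "group (Aut \<Gamma>)"
proof (rule groupI)
  have bv: "beg \<Gamma> x \<in> verts \<Gamma>" "dinv \<Gamma> x \<in> darts \<Gamma>"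
    "dinv \<Gamma> (dinv \<Gamma> x) = x" if "x \<in> darts \<Gamma>" for x
    using g that by (auto simp: is_graph_def)
  show "\<one>\<^bsub>Aut \<Gamma>\<^esub> \<in> carrier (Aut \<Gamma>)"
    using bv by (auto simp: Aut_def is_isomorphism_def is_morphism_def bij_betw_def inj_on_def)
  show "x \<otimes>\<^bsub>Aut \<Gamma>\<^esub> y \<in> carrier (Aut \<Gamma>)"
    if x: "x \<in> carrier (Aut \<Gamma>)" and y: "y \<in> carrier (Aut \<Gamma>)" for x y
  proof -
    have "bij_betw (compose (elems \<Gamma>) y x) (elems \<Gamma>) (elems \<Gamma>)"
      using Aut_carrierD(2)[OF x] Aut_carrierD(2)[OF y] by (rule bij_betw_compose)
    then show ?thesis
      using Aut_carrierD[OF x] Aut_carrierD[OF y] bv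
      by (auto simp: Aut_def is_isomorphism_def is_morphism_def compose_def)
  qed
  show "x \<otimes>\<^bsub>Aut \<Gamma>\<^esub> y \<otimes>\<^bsub>Aut \<Gamma>\<^esub> z = x \<otimes>\<^bsub>Aut \<Gamma>\<^esub> (y \<otimes>\<^bsub>Aut \<Gamma>\<^esub> z)"
    if x: "x \<in> carrier (Aut \<Gamma>)" and "y \<in> carrier (Aut \<Gamma>)" "z \<in> carrier (Aut \<Gamma>)" for x y z
  proof -
    have "x a \<in> elems \<Gamma>" if "a \<in> elems \<Gamma>" for a
      using that Aut_carrierD(3,4)[OF x] by auto
    then show ?thesis by (auto simp: Aut_def compose_def fun_eq_iff)
  qed
  show "\<one>\<^bsub>Aut \<Gamma>\<^esub> \<otimes>\<^bsub>Aut \<Gamma>\<^esub> x = x" if x: "x \<in> carrier (Aut \<Gamma>)" for x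
    using Aut_carrierD(1)[OF x]
    by (auto simp: Aut_def compose_def fun_eq_iff extensional_def)
  show "\<exists>y \<in> carrier (Aut \<Gamma>). y \<otimes>\<^bsub>Aut \<Gamma>\<^esub> x = \<one>\<^bsub>Aut \<Gamma>\<^esub>"
    if x: "x \<in> carrier (Aut \<Gamma>)" for x
  proof -
    let ?E = "elems \<Gamma>"
    define y where "y = restrict (inv_into ?E x) ?E"
    note X = Aut_carrierD[OF x]
    have inj: "inj_on x ?E" and im: "x ` ?E = ?E"
      using X(2) by (auto simp: bij_betw_def)
    have yE: "y a \<in> ?E" and xy: "x (y a) = a" if "a \<in> ?E" for a
      using that im inv_into_into[of a x ?E] f_inv_into_f[of a x ?E] by (simp_all add: y_def)
    have yx: "y (x a) = a" if "a \<in> ?E" for a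
      using that X(3,4) inj by (auto simp: y_def)
    have disj: "verts \<Gamma> \<inter> darts \<Gamma> = {}"
      using g by (simp add: is_graph_def)
    have yv: "y a \<in> verts \<Gamma>" if "a \<in> verts \<Gamma>" for a
      using that yE[of a] xy[of a] X(4)[of "y a"] disj by auto
    have yd: "y a \<in> darts \<Gamma>" if "a \<in> darts \<Gamma>" for a
      using that yE[of a] xy[of a] X(3)[of "y a"] disj by auto
    have yb: "y (beg \<Gamma> a) = beg \<Gamma> (y a)" if a: "a \<in> darts \<Gamma>" for a
      using X(5)[OF yd[OF a]] xy[of a] yx[of "beg \<Gamma> (y a)"] bv(1)[OF yd[OF a]] a by auto
    have yr: "y (dinv \<Gamma> a) = dinv \<Gamma> (y a)" if a: "a \<in> darts \<Gamma>" for a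
      using X(6)[OF yd[OF a]] xy[of a] yx[of "dinv \<Gamma> (y a)"] bv(2)[OF yd[OF a]] a by auto
    have "bij_betw y ?E ?E"
      unfolding y_def bij_betw_restrict_eq by (rule bij_betw_inv_into[OF X(2)])
    then have "y \<in> carrier (Aut \<Gamma>)"
      using yv yd yb yr by (auto simp: Aut_def is_isomorphism_def is_morphism_def y_def)
    moreover have "y \<otimes>\<^bsub>Aut \<Gamma>\<^esub> x = \<one>\<^bsub>Aut \<Gamma>\<^esub>"
      using xy by (auto simp: Aut_def compose_def fun_eq_iff)
    ultimately show ?thesis by blast
  qed
qed


section \<open>Orbits, stabilisers and quotients\<close>

abbreviation aut_orbit :: "'a dart_graph \<Rightarrow> ('a \<Rightarrow> 'a) set \<Rightarrow> 'a \<Rightarrow> 'a set" where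
  "aut_orbit \<Gamma> G x \<equiv> orbit ((Aut \<Gamma>)\<lparr>carrier := G\<rparr>) (\<lambda>g. g) x"

abbreviation aut_stabilizer :: "'a dart_graph \<Rightarrow> ('a \<Rightarrow> 'a) set \<Rightarrow> 'a \<Rightarrow> ('a \<Rightarrow> 'a) set" where
  "aut_stabilizer \<Gamma> G x \<equiv> stabilizer ((Aut \<Gamma>)\<lparr>carrier := G\<rparr>) (\<lambda>g. g) x"

lemma aut_orbit_iff: "y \<in> aut_orbit \<Gamma> G x \<longleftrightarrow> (\<exists>g \<in> G. y = g x)"
  by (auto simp: orbit_def)

lemma aut_stabilizer_iff: "g \<in> aut_stabilizer \<Gamma> G x \<longleftrightarrow> g \<in> G \<and> g x = x"
  by (simp add: stabilizer_def)

text \<open>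
  The unions below only serve to pick a representative: all the sets united are equal
  (\<open>beg_quotient_graph\<close> and \<open>dinv_quotient_graph\<close> below).
\<close>

definition quotient_graph :: "'a dart_graph \<Rightarrow> ('a \<Rightarrow> 'a) set \<Rightarrow> 'a set dart_graph" where
  "quotient_graph \<Gamma> G =
     \<lparr>verts = aut_orbit \<Gamma> G ` verts \<Gamma>,
      darts = aut_orbit \<Gamma> G ` darts \<Gamma>,
      beg = (\<lambda>X. \<Union>x \<in> X. aut_orbit \<Gamma> G (beg \<Gamma> x)),
      dinv = (\<lambda>X. \<Union>x \<in> X. aut_orbit \<Gamma> G (dinv \<Gamma> x))\<rparr>"

lemma aut_orbit_refl:
  assumes "subgroup G (Aut \<Gamma>)" "x \<in> elems \<Gamma>"
  shows "x \<in> aut_orbit \<Gamma> G x"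
proof -
  have "\<one>\<^bsub>Aut \<Gamma>\<^esub> \<in> G" using assms(1) by (rule subgroup.one_closed)
  moreover have "\<one>\<^bsub>Aut \<Gamma>\<^esub> x = x" using assms(2) by (simp add: Aut_def)
  ultimately show ?thesis unfolding aut_orbit_iff by metis
qed

lemma aut_orbit_image:
  assumes g: "is_graph \<Gamma>" and G: "subgroup G (Aut \<Gamma>)" and h: "h \<in> G" and x: "x \<in> elems \<Gamma>"
  shows "aut_orbit \<Gamma> G (h x) = aut_orbit \<Gamma> G x"
proof -
  interpret group "Aut \<Gamma>" using g by (rule group_Aut)
  have sub: "aut_orbit \<Gamma> G (k y) \<subseteq> aut_orbit \<Gamma> G y" if k: "k \<in> G" and y: "y \<in> elems \<Gamma>" for k y
  proof
    fix z assume "z \<in> aut_orbit \<Gamma> G (k y)"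
    then obtain l where l: "l \<in> G" "z = l (k y)" unfolding aut_orbit_iff by blast
    have "k \<otimes>\<^bsub>Aut \<Gamma>\<^esub> l \<in> G" using subgroup.m_closed[OF G k l(1)] .
    moreover have "(k \<otimes>\<^bsub>Aut \<Gamma>\<^esub> l) y = z" using y l(2) by (simp add: Aut_def compose_def)
    ultimately show "z \<in> aut_orbit \<Gamma> G y" unfolding aut_orbit_iff by metis
  qed
  have hc: "h \<in> carrier (Aut \<Gamma>)" using subgroup.subset[OF G] h by auto
  have hx: "h x \<in> elems \<Gamma>" using Aut_carrierD(3,4)[OF hc] x by auto
  have iG: "inv\<^bsub>Aut \<Gamma>\<^esub> h \<in> G" using subgroup.m_inv_closed[OF G h] .
  have "(inv\<^bsub>Aut \<Gamma>\<^esub> h) (h x) = (h \<otimes>\<^bsub>Aut \<Gamma>\<^esub> inv\<^bsub>Aut \<Gamma>\<^esub> h) x"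
    using x by (simp add: Aut_def compose_def)
  also have "\<dots> = x" unfolding r_inv[OF hc] using x by (simp add: Aut_def)
  finally show ?thesis using sub[OF h x] sub[OF iG hx] by auto
qed

lemma beg_quotient_graph:
  assumes g: "is_graph \<Gamma>" and G: "subgroup G (Aut \<Gamma>)" and x: "x \<in> darts \<Gamma>"
  shows "beg (quotient_graph \<Gamma> G) (aut_orbit \<Gamma> G x) = aut_orbit \<Gamma> G (beg \<Gamma> x)"
proof -
  have "aut_orbit \<Gamma> G (beg \<Gamma> y) = aut_orbit \<Gamma> G (beg \<Gamma> x)" if y: "y \<in> aut_orbit \<Gamma> G x" for y
  proof -
    obtain h where h: "h \<in> G" "y = h x" using y unfolding aut_orbit_iff by blast
    have hc: "h \<in> carrier (Aut \<Gamma>)" using subgroup.subset[OF G] h by auto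
    have "beg \<Gamma> x \<in> elems \<Gamma>" using g x by (auto simp: is_graph_def)
    from aut_orbit_image[OF g G h(1) this] show ?thesis
      unfolding h(2) Aut_carrierD(5)[OF hc x] .
  qed
  then have "(\<Union>y \<in> aut_orbit \<Gamma> G x. aut_orbit \<Gamma> G (beg \<Gamma> y)) = aut_orbit \<Gamma> G (beg \<Gamma> x)"
    using aut_orbit_refl[OF G, of x] x by (intro UN_constant_eq[of x]) blast+
  then show ?thesis by (simp only: quotient_graph_def dart_graph.simps)
qed

lemma dinv_quotient_graph:
  assumes g: "is_graph \<Gamma>" and G: "subgroup G (Aut \<Gamma>)" and x: "x \<in> darts \<Gamma>"
  shows "dinv (quotient_graph \<Gamma> G) (aut_orbit \<Gamma> G x) =
    aut_orbit \<Gamma> G (dinv \<Gamma> x)"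
proof -
  have "aut_orbit \<Gamma> G (dinv \<Gamma> y) = aut_orbit \<Gamma> G (dinv \<Gamma> x)"
    if y: "y \<in> aut_orbit \<Gamma> G x" for y
  proof -
    obtain h where h: "h \<in> G" "y = h x" using y unfolding aut_orbit_iff by blast
    have hc: "h \<in> carrier (Aut \<Gamma>)" using subgroup.subset[OF G] h by auto
    have "dinv \<Gamma> x \<in> elems \<Gamma>" using g x by (auto simp: is_graph_def)
    from aut_orbit_image[OF g G h(1) this] show ?thesis
      unfolding h(2) Aut_carrierD(6)[OF hc x] .
  qed
  then have "(\<Union>y \<in> aut_orbit \<Gamma> G x. aut_orbit \<Gamma> G (dinv \<Gamma> y)) = aut_orbit \<Gamma> G (dinv \<Gamma> x)"
    using aut_orbit_refl[OF G, of x] x by (intro UN_constant_eq[of x]) blast+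
  then show ?thesis by (simp only: quotient_graph_def dart_graph.simps)
qed

lemma is_graph_quotient_graph:
  assumes g: "is_graph \<Gamma>" and G: "subgroup G (Aut \<Gamma>)"
  shows "is_graph (quotient_graph \<Gamma> G)"
proof -
  have disj: "aut_orbit \<Gamma> G v \<noteq> aut_orbit \<Gamma> G x"
    if v: "v \<in> verts \<Gamma>" and x: "x \<in> darts \<Gamma>" for v x
  proof
    assume "aut_orbit \<Gamma> G v = aut_orbit \<Gamma> G x"
    then have "v \<in> aut_orbit \<Gamma> G x" using aut_orbit_refl[OF G, of v] v by auto
    then obtain h where h: "h \<in> G" "v = h x" unfolding aut_orbit_iff by blast
    then have "v \<in> darts \<Gamma>" using Aut_carrierD(4)[of h \<Gamma> x] subgroup.subset[OF G] x by auto
    then show False using g v by (auto simp: is_graph_def)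
  qed
  have V: "verts (quotient_graph \<Gamma> G) = aut_orbit \<Gamma> G ` verts \<Gamma>"
    and D: "darts (quotient_graph \<Gamma> G) = aut_orbit \<Gamma> G ` darts \<Gamma>"
    by (simp_all add: quotient_graph_def)
  have r: "dinv \<Gamma> x \<in> darts \<Gamma>" "dinv \<Gamma> (dinv \<Gamma> x) = x"
    "beg \<Gamma> x \<in> verts \<Gamma>" if "x \<in> darts \<Gamma>" for x
    using g that by (auto simp: is_graph_def)
  have ne: "verts \<Gamma> \<noteq> {}" using g by (simp add: is_graph_def)
  show ?thesis
    unfolding is_graph_def V D
  proof (intro conjI ballI)
    show "aut_orbit \<Gamma> G ` verts \<Gamma> \<noteq> {}" using ne by blast
    show "aut_orbit \<Gamma> G ` verts \<Gamma> \<inter> aut_orbit \<Gamma> G ` darts \<Gamma> = {}" using disj by blast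
  next
    fix X assume "X \<in> aut_orbit \<Gamma> G ` darts \<Gamma>"
    then obtain x where x: "x \<in> darts \<Gamma>" and X: "X = aut_orbit \<Gamma> G x" by blast
    show "beg (quotient_graph \<Gamma> G) X \<in> aut_orbit \<Gamma> G ` verts \<Gamma>"
      unfolding X beg_quotient_graph[OF g G x] using r(3)[OF x] by (rule imageI)
    show "dinv (quotient_graph \<Gamma> G) X \<in> aut_orbit \<Gamma> G ` darts \<Gamma>"
      unfolding X dinv_quotient_graph[OF g G x] using r(1)[OF x] by (rule imageI)
    show "dinv (quotient_graph \<Gamma> G) (dinv (quotient_graph \<Gamma> G) X) = X"
      unfolding X dinv_quotient_graph[OF g G x] dinv_quotient_graph[OF g G r(1)[OF x]] r(2)[OF x] ..
  qed
qed

end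

theory Submission
  imports Defs
begin

text \<open>
  Let \<open>K\<close> be the subgroup generated by the stabilisers \<open>G\<^sub>v\<close>, \<open>v \<in> V(\<Gamma>')\<close>. A dart of \<open>\<Gamma>\<close> that starts
  at a vertex \<open>w\<close> of \<open>\<Gamma>'\<close> is the image of a dart of \<open>\<Gamma>'\<close> under an element of \<open>G\<^sub>w\<close>, so the
  \<open>K\<close>-translates of \<open>V(\<Gamma>')\<close> are closed under adjacency. If \<open>\<Gamma>\<close> is connected they exhaust \<open>V(\<Gamma>)\<close>,
  and then every \<open>g \<in> G\<close> agrees at a vertex \<open>w\<close> of \<open>\<Gamma>'\<close> with some \<open>k \<in> K\<close>, whence \<open>g \<in> G\<^sub>w k\<close>.
  Conversely, \<open>\<Gamma>'\<close> is connected, and a generator of \<open>K\<close> fixes a vertex of \<open>\<Gamma>'\<close>; so the translates of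
  \<open>\<Gamma>'\<close> under \<open>K\<close> all lie in one connected component.
\<close>

section \<open>Walks and the closure of the adjacency relation\<close>

definition adjacency :: "'a dart_graph \<Rightarrow> 'a rel" where
  "adjacency \<Gamma> = (\<lambda>x. (beg \<Gamma> x, dend \<Gamma> x)) ` darts \<Gamma>"

lemma is_graphD:
  assumes "is_graph \<Gamma>" "x \<in> darts \<Gamma>"
  shows "beg \<Gamma> x \<in> verts \<Gamma>" "dinv \<Gamma> x \<in> darts \<Gamma>" "dinv \<Gamma> (dinv \<Gamma> x) = x" "dend \<Gamma> x \<in> verts \<Gamma>"
  using assms by (auto simp: is_graph_def dend_def)

lemma sym_adjacency:
  assumes "is_graph \<Gamma>"
  shows "sym (adjacency \<Gamma>)"
proof (rule symI)
  fix u v assume "(u, v) \<in> adjacency \<Gamma>"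
  then obtain x where x: "x \<in> darts \<Gamma>" "u = beg \<Gamma> x" "v = dend \<Gamma> x"
    by (auto simp: adjacency_def)
  have "(v, u) = (beg \<Gamma> (dinv \<Gamma> x), dend \<Gamma> (dinv \<Gamma> x))"
    using x is_graphD(3)[OF assms x(1)] by (simp add: dend_def)
  then show "(v, u) \<in> adjacency \<Gamma>"
    using is_graphD(2)[OF assms x(1)] unfolding adjacency_def by blast
qed

lemma walk_snoc:
  "walk \<Gamma> (xs @ [x]) \<longleftrightarrow> walk \<Gamma> xs \<and> x \<in> darts \<Gamma> \<and> (xs \<noteq> [] \<longrightarrow> dend \<Gamma> (last xs) = beg \<Gamma> x)"
  by (auto simp: walk_def successively_append_iff)

lemma walk_imp_rtrancl:
  assumes "walk \<Gamma> xs" "xs \<noteq> []"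
  shows "(beg \<Gamma> (hd xs), dend \<Gamma> (last xs)) \<in> (adjacency \<Gamma>)\<^sup>*"
  using assms
proof (induction xs rule: rev_induct)
  case (snoc x xs)
  have x: "(beg \<Gamma> x, dend \<Gamma> x) \<in> adjacency \<Gamma>"
    using snoc.prems(1) by (auto simp: walk_snoc adjacency_def)
  show ?case
  proof (cases "xs = []")
    case False
    with snoc have "(beg \<Gamma> (hd xs), beg \<Gamma> x) \<in> (adjacency \<Gamma>)\<^sup>*"
      by (auto simp: walk_snoc)
    with x False show ?thesis by simp
  qed (use x in auto)
qed simp

text \<open>The empty walk matches reflexivity and appending a dart matches a step of
  \<open>rtrancl\<close>. Since \<open>rtrancl\<close> relates every element of the type to itself,
  the endpoints have to be assumed to be vertices.\<close>

lemma ex_walk_iff_rtrancl: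
  assumes g: "is_graph \<Gamma>" and u: "u \<in> verts \<Gamma>" and v: "v \<in> verts \<Gamma>"
  shows "(\<exists>xs. walk_from_to \<Gamma> u xs v) \<longleftrightarrow> (u, v) \<in> (adjacency \<Gamma>)\<^sup>*"
proof
  assume "\<exists>xs. walk_from_to \<Gamma> u xs v"
  then show "(u, v) \<in> (adjacency \<Gamma>)\<^sup>*"
    using walk_imp_rtrancl by (fastforce simp: walk_from_to_def split: if_splits)
next
  assume "(u, v) \<in> (adjacency \<Gamma>)\<^sup>*"
  then show "\<exists>xs. walk_from_to \<Gamma> u xs v"
  proof induction
    case base
    have "walk_from_to \<Gamma> u [] u" using u by (simp add: walk_from_to_def walk_def)
    then show ?case ..
  next
    case (step v w)
    then obtain x xs where x: "x \<in> darts \<Gamma>" "v = beg \<Gamma> x" "w = dend \<Gamma> x"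
      and xs: "walk_from_to \<Gamma> u xs v"
      by (auto simp: adjacency_def)
    have "walk_from_to \<Gamma> u (xs @ [x]) w"
      using xs x is_graphD(4)[OF g x(1)]
      by (auto simp: walk_from_to_def walk_snoc split: if_splits)
    then show ?case ..
  qed
qed

lemma graph_connected_iff:
  assumes "is_graph \<Gamma>"
  shows "graph_connected \<Gamma> \<longleftrightarrow> (\<forall>u \<in> verts \<Gamma>. \<forall>v \<in> verts \<Gamma>. (u, v) \<in> (adjacency \<Gamma>)\<^sup>*)"
  unfolding graph_connected_def using ex_walk_iff_rtrancl[OF assms] by blast

section \<open>Transport of connectedness along morphisms\<close>

lemma adjacency_morphism:
  assumes "is_graph \<Gamma>" "is_morphism \<Gamma> \<Delta> f" "(u, v) \<in> adjacency \<Gamma>"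
  shows "(f u, f v) \<in> adjacency \<Delta>"
proof -
  obtain x where x: "x \<in> darts \<Gamma>" "u = beg \<Gamma> x" "v = dend \<Gamma> x"
    using assms(3) by (auto simp: adjacency_def)
  have "(f u, f v) = (beg \<Delta> (f x), dend \<Delta> (f x))" "f x \<in> darts \<Delta>"
    using assms(2) x is_graphD[OF assms(1) x(1)] by (auto simp: is_morphism_def dend_def)
  then show ?thesis unfolding adjacency_def by blast
qed

lemma adjacency_rtrancl_morphism:
  assumes "is_graph \<Gamma>" "is_morphism \<Gamma> \<Delta> f" "(u, v) \<in> (adjacency \<Gamma>)\<^sup>*"
  shows "(f u, f v) \<in> (adjacency \<Delta>)\<^sup>*"
  using assms(3)
proof induction
  case (step v w)
  from step.IH adjacency_morphism[OF assms(1,2) step.hyps(2)] show ?case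
    by (rule rtrancl_into_rtrancl)
qed simp

text \<open>Bijectivity is only given on the union of vertices and darts. It splits because each
  part maps into its counterpart and the two parts of \<open>\<Delta>\<close> are disjoint.\<close>

lemma isomorphism_image:
  assumes \<Delta>: "is_graph \<Delta>" and f: "is_isomorphism \<Gamma> \<Delta> f"
  shows "f ` verts \<Gamma> = verts \<Delta>" "f ` darts \<Gamma> = darts \<Delta>"
proof -
  have "f ` verts \<Gamma> \<union> f ` darts \<Gamma> = verts \<Delta> \<union> darts \<Delta>"
    using f by (auto simp: is_isomorphism_def bij_betw_def image_Un)
  moreover have "f ` verts \<Gamma> \<subseteq> verts \<Delta>" "f ` darts \<Gamma> \<subseteq> darts \<Delta>" "verts \<Delta> \<inter> darts \<Delta> = {}"
    using f \<Delta> by (auto simp: is_isomorphism_def is_morphism_def is_graph_def)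
  ultimately show "f ` verts \<Gamma> = verts \<Delta>" "f ` darts \<Gamma> = darts \<Delta>" by blast+
qed

lemma isomorphism_inv_into:
  assumes \<Gamma>: "is_graph \<Gamma>" and \<Delta>: "is_graph \<Delta>" and f: "is_isomorphism \<Gamma> \<Delta> f"
  shows "is_morphism \<Delta> \<Gamma> (inv_into (elems \<Gamma>) f)"
proof -
  let ?h = "inv_into (elems \<Gamma>) f"
  have inj: "inj_on f (elems \<Gamma>)"
    using f by (simp add: is_isomorphism_def bij_betw_def)
  have h: "?h (f a) = a" if "a \<in> elems \<Gamma>" for a
    using inj that by (rule inv_into_f_f)
  note im = isomorphism_image[OF \<Delta> f]
  have "?h (beg \<Delta> y) = beg \<Gamma> (?h y) \<and> ?h (dinv \<Delta> y) = dinv \<Gamma> (?h y)" if "y \<in> darts \<Delta>" for y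
  proof -
    from that im(2) obtain x where x: "x \<in> darts \<Gamma>" "y = f x" by blast
    have "beg \<Delta> y = f (beg \<Gamma> x)" "dinv \<Delta> y = f (dinv \<Gamma> x)"
      using f x by (auto simp: is_isomorphism_def is_morphism_def)
    then show ?thesis using x is_graphD[OF \<Gamma> x(1)] h by simp
  qed
  moreover have "?h ` verts \<Delta> \<subseteq> verts \<Gamma>" "?h ` darts \<Delta> \<subseteq> darts \<Gamma>"
    using h unfolding im[symmetric] by auto
  ultimately show ?thesis by (auto simp: is_morphism_def)
qed

text \<open>Adjacency chains in \<open>\<Delta>\<close> are pulled back along the inverse map, which
  is again a morphism.\<close>

lemma graph_connected_isomorphism:
  assumes \<Gamma>: "is_graph \<Gamma>" and \<Delta>: "is_graph \<Delta>" and f: "is_isomorphism \<Gamma> \<Delta> f"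
    and c: "graph_connected \<Delta>"
  shows "graph_connected \<Gamma>"
  unfolding graph_connected_iff[OF \<Gamma>]
proof (intro ballI)
  fix u v assume u: "u \<in> verts \<Gamma>" and v: "v \<in> verts \<Gamma>"
  then have "(f u, f v) \<in> (adjacency \<Delta>)\<^sup>*"
    using c isomorphism_image(1)[OF \<Delta> f] by (auto simp: graph_connected_iff[OF \<Delta>])
  from adjacency_rtrancl_morphism[OF \<Delta> isomorphism_inv_into[OF \<Gamma> \<Delta> f] this]
  show "(u, v) \<in> (adjacency \<Gamma>)\<^sup>*"
    using f u v by (simp add: is_isomorphism_def bij_betw_def inv_into_f_f)
qed

lemma subgraph_inclusion_morphism:
  assumes "is_subgraph \<Delta> \<Gamma>"
  shows "is_morphism \<Delta> \<Gamma> (\<lambda>x. x)"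
  using assms by (auto simp: is_subgraph_def is_morphism_def)

section \<open>Pointwise action of automorphisms\<close>

lemma Aut_mult_apply: "x \<in> elems \<Gamma> \<Longrightarrow> (g \<otimes>\<^bsub>Aut \<Gamma>\<^esub> h) x = h (g x)"
  by (simp add: Aut_def compose_def)

lemma Aut_one_apply: "x \<in> elems \<Gamma> \<Longrightarrow> \<one>\<^bsub>Aut \<Gamma>\<^esub> x = x"
  by (simp add: Aut_def)

lemma Aut_inv_apply:
  assumes "is_graph \<Gamma>" "g \<in> carrier (Aut \<Gamma>)" "x \<in> elems \<Gamma>"
  shows "(inv\<^bsub>Aut \<Gamma>\<^esub> g) (g x) = x"
proof -
  interpret group "Aut \<Gamma>" using assms(1) by (rule group_Aut)
  have "(inv\<^bsub>Aut \<Gamma>\<^esub> g) (g x) = (g \<otimes>\<^bsub>Aut \<Gamma>\<^esub> inv\<^bsub>Aut \<Gamma>\<^esub> g) x"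
    using assms(3) by (simp add: Aut_mult_apply)
  then show ?thesis using assms by (simp add: Aut_one_apply)
qed

lemma Aut_dend:
  assumes "is_graph \<Gamma>" "g \<in> carrier (Aut \<Gamma>)" "x \<in> darts \<Gamma>"
  shows "g (dend \<Gamma> x) = dend \<Gamma> (g x)"
  using Aut_carrierD(5,6)[OF assms(2)] assms(3) is_graphD[OF assms(1,3)] by (simp add: dend_def)

section \<open>The subgraph as a transversal of the orbits\<close>

locale orbit_transversal =
  fixes \<Gamma> \<Gamma>' :: "'a dart_graph" and G :: "('a \<Rightarrow> 'a) set"
  assumes graph: "is_graph \<Gamma>"
    and subgroup: "subgroup G (Aut \<Gamma>)"
    and subgraph: "is_subgraph \<Gamma>' \<Gamma>"
    and iso: "is_isomorphism \<Gamma>' (quotient_graph \<Gamma> G) (aut_orbit \<Gamma> G)"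
begin

abbreviation K :: "('a \<Rightarrow> 'a) set" where
  "K \<equiv> generate (Aut \<Gamma>) (\<Union>v \<in> verts \<Gamma>'. aut_stabilizer \<Gamma> G v)"

sublocale group "Aut \<Gamma>"
  using graph by (rule group_Aut)

lemma graph': "is_graph \<Gamma>'"
  and verts': "verts \<Gamma>' \<subseteq> verts \<Gamma>"
  and darts': "darts \<Gamma>' \<subseteq> darts \<Gamma>"
  and beg': "x \<in> darts \<Gamma>' \<Longrightarrow> beg \<Gamma>' x = beg \<Gamma> x"
  and dend': "x \<in> darts \<Gamma>' \<Longrightarrow> dend \<Gamma>' x = dend \<Gamma> x"
  using subgraph by (auto simp: is_subgraph_def dend_def is_graph_def)

lemma G_carrier: "g \<in> G \<Longrightarrow> g \<in> carrier (Aut \<Gamma>)"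
  using subgroup.mem_carrier[OF subgroup] .

lemma stabilizers_subset: "(\<Union>v \<in> verts \<Gamma>'. aut_stabilizer \<Gamma> G v) \<subseteq> G"
  by (auto simp: aut_stabilizer_iff)

lemma K_subgroup: "subgroup K (Aut \<Gamma>)"
  using stabilizers_subset G_carrier by (intro generate_is_subgroup) blast

lemma K_subset: "K \<subseteq> G"
  using stabilizers_subset subgroup by (rule generate_subgroup_incl)

lemma stabilizer_in_K: "v \<in> verts \<Gamma>' \<Longrightarrow> g \<in> G \<Longrightarrow> g v = v \<Longrightarrow> g \<in> K"
  by (rule generate.incl) (auto simp: aut_stabilizer_iff)

text \<open>This is injectivity of the quotient map on \<open>\<Gamma>'\<close>. It is what turns an
  element moving one vertex of \<open>\<Gamma>'\<close> to another into a stabiliser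
  element.\<close>

lemma transversal_unique:
  assumes "v \<in> verts \<Gamma>'" "w \<in> verts \<Gamma>'" "g \<in> G" "w = g v"
  shows "w = v"
proof -
  have "aut_orbit \<Gamma> G w = aut_orbit \<Gamma> G v"
    unfolding assms(4) using assms(1) verts' by (intro aut_orbit_image graph subgroup assms(3)) blast
  moreover have "inj_on (aut_orbit \<Gamma> G) (elems \<Gamma>')"
    using iso by (simp add: is_isomorphism_def bij_betw_def)
  ultimately show ?thesis using assms(1,2) by (blast dest: inj_onD)
qed

text \<open>This is surjectivity of the quotient map, used separately on vertices and on
  darts.\<close>

lemma transversal_exists:
  shows "u \<in> verts \<Gamma> \<Longrightarrow> \<exists>v \<in> verts \<Gamma>'. \<exists>g \<in> G. u = g v"
    and "x \<in> darts \<Gamma> \<Longrightarrow> \<exists>y \<in> darts \<Gamma>'. \<exists>g \<in> G. x = g y"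
proof -
  note im = isomorphism_image[OF is_graph_quotient_graph[OF graph subgroup] iso]
  show "\<exists>v \<in> verts \<Gamma>'. \<exists>g \<in> G. u = g v" if "u \<in> verts \<Gamma>"
  proof -
    have "aut_orbit \<Gamma> G u \<in> aut_orbit \<Gamma> G ` verts \<Gamma>'"
      unfolding im(1) using that by (simp add: quotient_graph_def)
    then obtain v where v: "v \<in> verts \<Gamma>'" "aut_orbit \<Gamma> G u = aut_orbit \<Gamma> G v"
      by (rule imageE)
    have "u \<in> aut_orbit \<Gamma> G u"
      using that by (intro aut_orbit_refl[OF subgroup]) simp
    then have "\<exists>g \<in> G. u = g v"
      unfolding v(2) aut_orbit_iff .
    with v(1) show ?thesis by blast
  qed
  show "\<exists>y \<in> darts \<Gamma>'. \<exists>g \<in> G. x = g y" if "x \<in> darts \<Gamma>"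
  proof -
    have "aut_orbit \<Gamma> G x \<in> aut_orbit \<Gamma> G ` darts \<Gamma>'"
      unfolding im(2) using that by (simp add: quotient_graph_def)
    then obtain y where y: "y \<in> darts \<Gamma>'" "aut_orbit \<Gamma> G x = aut_orbit \<Gamma> G y"
      by (rule imageE)
    have "x \<in> aut_orbit \<Gamma> G x"
      using that by (intro aut_orbit_refl[OF subgroup]) simp
    then have "\<exists>g \<in> G. x = g y"
      unfolding y(2) aut_orbit_iff .
    with y(1) show ?thesis by blast
  qed
qed

section \<open>Connectedness forces generation by stabilisers\<close>

lemma translates_adjacency_closed:
  assumes k: "k \<in> K" and w: "w \<in> verts \<Gamma>'" and x: "x \<in> darts \<Gamma>" "beg \<Gamma> x = k w"
  shows "\<exists>l \<in> K. \<exists>v \<in> verts \<Gamma>'. dend \<Gamma> x = l v"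
proof -
  have wE: "w \<in> elems \<Gamma>" using w verts' by blast
  have kG: "k \<in> G" using k K_subset by blast
  have kc: "k \<in> carrier (Aut \<Gamma>)" using kG by (rule G_carrier)
  obtain y g where y: "y \<in> darts \<Gamma>'" and g: "g \<in> G" and xy: "x = g y"
    using transversal_exists(2)[OF x(1)] by blast
  have yD: "y \<in> darts \<Gamma>" using y darts' by blast
  note yV = is_graphD[OF graph yD]
  have gb: "g (beg \<Gamma> y) = k w"
    using Aut_carrierD(5)[OF G_carrier[OF g] yD] x(2) xy by simp
  \<comment> \<open>The left factor acts first, so \<open>h\<close> applies \<open>g\<close> and
    then undoes \<open>k\<close>; this brings the start of \<open>x\<close> back to
    \<open>w\<close>.\<close>
  define h where "h = g \<otimes>\<^bsub>Aut \<Gamma>\<^esub> inv\<^bsub>Aut \<Gamma>\<^esub> k"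
  have h: "h \<in> G"
    unfolding h_def using g kG subgroup by (simp add: subgroup.m_closed subgroup.m_inv_closed)
  have hb: "h (beg \<Gamma> y) = w"
    using yV(1) gb Aut_inv_apply[OF graph kc wE] by (simp add: h_def Aut_mult_apply)
  have by': "beg \<Gamma> y \<in> verts \<Gamma>'"
    using is_graphD(1)[OF graph' y] beg'[OF y] by simp
  \<comment> \<open>Both are vertices of \<open>\<Gamma>'\<close> in one \<open>G\<close>-orbit.
    Hence \<open>h\<close> fixes \<open>w\<close> and is one of the generators of \<open>K\<close>,
    so that \<open>g\<close>, being \<open>h\<close> followed by \<open>k\<close>, lies in
    \<open>K\<close> too.\<close>
  have "w = beg \<Gamma> y"
    using transversal_unique[OF by' w h] hb by simp
  with hb h w have "h \<in> K" using stabilizer_in_K by simp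
  then have "h \<otimes>\<^bsub>Aut \<Gamma>\<^esub> k \<in> K"
    using k by (rule subgroup.m_closed[OF K_subgroup])
  moreover have "h \<otimes>\<^bsub>Aut \<Gamma>\<^esub> k = g"
    using kc G_carrier[OF g] by (simp add: h_def m_assoc)
  moreover have "dend \<Gamma> x = g (dend \<Gamma> y)"
    using Aut_dend[OF graph G_carrier[OF g] yD] xy by simp
  moreover have "dend \<Gamma> y \<in> verts \<Gamma>'"
    using is_graphD(4)[OF graph' y] dend'[OF y] by simp
  ultimately show ?thesis by blast
qed

lemma connected_imp_generated:
  assumes "graph_connected \<Gamma>"
  shows "G = K"
proof
  obtain w where w: "w \<in> verts \<Gamma>'" using graph' by (auto simp: is_graph_def)
  have wV: "w \<in> verts \<Gamma>" using w verts' by blast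
  show "G \<subseteq> K"
  proof
    fix g assume g: "g \<in> G"
    have "(w, g w) \<in> (adjacency \<Gamma>)\<^sup>*"
      using assms wV Aut_carrierD(3)[OF G_carrier[OF g] wV] by (simp add: graph_connected_iff[OF graph])
    \<comment> \<open>Induction along the chain from \<open>w\<close>: every vertex reached is a
      \<open>K\<close>-translate of a vertex of \<open>\<Gamma>'\<close>.\<close>
    then have "\<exists>k \<in> K. \<exists>v \<in> verts \<Gamma>'. g w = k v"
    proof induction
      case base
      have "w = \<one>\<^bsub>Aut \<Gamma>\<^esub> w" using wV by (simp add: Aut_one_apply)
      then show ?case using w generate.one by blast
    next
      case (step a b)
      then show ?case using translates_adjacency_closed by (fastforce simp: adjacency_def)
    qed
    then obtain k v where k: "k \<in> K" and v: "v \<in> verts \<Gamma>'" and gw: "g w = k v" by blast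
    have kG: "k \<in> G" using k K_subset by blast
    have vV: "v \<in> verts \<Gamma>" using v verts' by blast
    define h where "h = g \<otimes>\<^bsub>Aut \<Gamma>\<^esub> inv\<^bsub>Aut \<Gamma>\<^esub> k"
    have h: "h \<in> G"
      unfolding h_def using g kG subgroup by (simp add: subgroup.m_closed subgroup.m_inv_closed)
    have hw: "h w = v"
      using wV vV gw Aut_inv_apply[OF graph G_carrier[OF kG]] by (simp add: h_def Aut_mult_apply)
    \<comment> \<open>As \<open>h\<close> maps \<open>w\<close> to \<open>v\<close> inside
      \<open>\<Gamma>'\<close>, uniqueness gives \<open>v = w\<close>.\<close>
    with transversal_unique[OF w v h] have "h w = w" by simp
    with w h have "h \<in> K" by (rule stabilizer_in_K)
    then have "h \<otimes>\<^bsub>Aut \<Gamma>\<^esub> k \<in> K"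
      using k by (rule subgroup.m_closed[OF K_subgroup])
    then show "g \<in> K"
      using G_carrier[OF g] G_carrier[OF kG] by (simp add: h_def m_assoc)
  qed
qed (rule K_subset)

section \<open>Generation by stabilisers forces connectedness\<close>

lemma reach_G:
  assumes "g \<in> G" "(u, v) \<in> (adjacency \<Gamma>)\<^sup>*"
  shows "(g u, g v) \<in> (adjacency \<Gamma>)\<^sup>*"
  using G_carrier[OF assms(1)]
  by (intro adjacency_rtrancl_morphism[OF graph _ assms(2)]) (simp add: Aut_def is_isomorphism_def)

lemma generated_imp_connected:
  assumes conn: "graph_connected (quotient_graph \<Gamma> G)" and GK: "G = K"
  shows "graph_connected \<Gamma>"
proof -
  let ?R = "(adjacency \<Gamma>)\<^sup>*"
  have sym: "(b, a) \<in> ?R" if "(a, b) \<in> ?R" for a b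
    using sym_rtrancl[OF sym_adjacency[OF graph]] that by (rule symD)
  have \<Gamma>': "(u, v) \<in> ?R" if "u \<in> verts \<Gamma>'" "v \<in> verts \<Gamma>'" for u v
  proof -
    have "graph_connected \<Gamma>'"
      using graph_connected_isomorphism[OF graph' is_graph_quotient_graph[OF graph subgroup] iso conn] .
    then have "(u, v) \<in> (adjacency \<Gamma>')\<^sup>*"
      using that by (simp add: graph_connected_iff[OF graph'])
    then show ?thesis
      by (rule adjacency_rtrancl_morphism[OF graph' subgraph_inclusion_morphism[OF subgraph]])
  qed
  obtain w where w: "w \<in> verts \<Gamma>'" using graph' by (auto simp: is_graph_def)
  have wE: "w \<in> elems \<Gamma>" using w verts' by blast
  \<comment> \<open>The chain from \<open>v\<close> to \<open>w\<close> is mapped by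
    \<open>s\<close> to one from \<open>s v = v\<close> to \<open>s w\<close>; a chain from
    \<open>w\<close> to \<open>v\<close> is put in front.\<close>
  have fixing: "(w, s w) \<in> ?R" if s: "s \<in> G" "s v = v" and v: "v \<in> verts \<Gamma>'" for s v
    using \<Gamma>'[OF w v] reach_G[OF s(1) \<Gamma>'[OF v w]] s(2) by simp
  have K_reach: "(w, g w) \<in> ?R" if "g \<in> K" for g
    using that
  proof induction
    case one
    then show ?case using wE by (simp add: Aut_one_apply)
  next
    case (incl s)
    then show ?case using fixing by (auto simp: aut_stabilizer_iff)
  next
    \<comment> \<open>The inverse of a generator fixes the same vertex, so \<open>fixing\<close>
      applies to it as well.\<close>
    case (inv s)
    then obtain v where v: "v \<in> verts \<Gamma>'" and s: "s \<in> G" "s v = v"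
      by (auto simp: aut_stabilizer_iff)
    have "v \<in> elems \<Gamma>" using v verts' by blast
    from Aut_inv_apply[OF graph G_carrier[OF s(1)] this]
    have "(inv\<^bsub>Aut \<Gamma>\<^esub> s) v = v" by (simp add: s(2))
    with subgroup.m_inv_closed[OF subgroup s(1)] v show ?case by (blast intro: fixing)
  next
    case (eng g h)
    have "h \<in> G" using eng.hyps(2) K_subset by blast
    \<comment> \<open>Applying \<open>h\<close> to the chain from \<open>w\<close> to
      \<open>g w\<close> gives one from \<open>h w\<close> to \<open>h (g w)\<close>, and
      \<open>h w\<close> is reachable from \<open>w\<close>.\<close>
    from reach_G[OF this eng.IH(1)] eng.IH(2) have "(w, h (g w)) \<in> ?R" by simp
    then show ?case using wE by (simp add: Aut_mult_apply)
  qed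
  have "(w, u) \<in> ?R" if u: "u \<in> verts \<Gamma>" for u
  proof -
    obtain v g where v: "v \<in> verts \<Gamma>'" and g: "g \<in> G" and ug: "u = g v"
      using transversal_exists(1)[OF u] by blast
    \<comment> \<open>The route to \<open>u = g v\<close> passes through \<open>g w\<close>: first
      by \<open>K_reach\<close>, then inside the translate of \<open>\<Gamma>'\<close> by
      \<open>g\<close>.\<close>
    have "(w, g w) \<in> ?R" using K_reach g GK by blast
    also have "(g w, u) \<in> ?R" unfolding ug using g \<Gamma>'[OF w v] by (rule reach_G)
    finally show ?thesis .
  qed
  \<comment> \<open>Any two vertices are joined through \<open>w\<close>, one of the two chains
    being reversed.\<close>
  then show ?thesis
    unfolding graph_connected_iff[OF graph] using sym by (blast intro: rtrancl_trans)
qed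

end

theorem proposition5:
  fixes \<Gamma> \<Gamma>' :: "'a dart_graph" and G :: "('a \<Rightarrow> 'a) set"
  assumes "is_graph \<Gamma>"
    and "subgroup G (Aut \<Gamma>)"
    and "is_tree (quotient_graph \<Gamma> G)"
    and "is_subgraph \<Gamma>' \<Gamma>"
    and "is_isomorphism \<Gamma>' (quotient_graph \<Gamma> G) (aut_orbit \<Gamma> G)"
  shows "graph_connected \<Gamma> \<longleftrightarrow>
    G = generate (Aut \<Gamma>) (\<Union>v \<in> verts \<Gamma>'. aut_stabilizer \<Gamma> G v)"
proof -
  interpret orbit_transversal \<Gamma> \<Gamma>' G
    using assms(1,2,4,5) by (rule orbit_transversal.intro)
  have "graph_connected (quotient_graph \<Gamma> G)" using assms(3) by (simp add: is_tree_def)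
  from connected_imp_generated generated_imp_connected[OF this] show ?thesis by (rule iffI)
qed

end
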